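(* Let $(X,\rho,W)$ be a hyperbolic space, $(M,d)$ a metric space with the AFPP for nonexpansive mappings, and $(C_u)_{u\in M}$ a family of nonempty convex subsets of $X$ for which there is a nonexpansive function $\delta:M\to\bigcup_{u\in M}C_u$ with $\delta(u)\in C_u$ for all $u\in M$; fix such a $\delta$. Let $H:=\{(x,u): u\in M,\ x\in C_u\}$, regarded as a subspace of $(X\times M)_\infty$, and let $T:H\to H$ be a nonexpansive function such that $(P_1\circ T)(x,u)\in C_u$ for all $(x,u)\in H$. For $u\in M$ let $T_u:C_u\to C_u$, $T_u(x)=(P_1\circ T)(x,u)$. Assume that $$\sup_{u\in M} r_{C_u}(T_u)<\infty,$$ and that $\varphi:(0,\infty)\to(0,\infty)$ is such that for each $\varepsilon>0$ and each $v\in M$ there exists $x^*\in C_v$ satisfying $$\rho(\delta(v),x^* )\le\varphi(\varepsilon)\quad\text{and}\quad\rho(x^*,T_v(x^* ))\le\sup_{u\in M}r_{C_u}(T_u)+\varepsilon.$$ Then $$r_H(T)\le\sup_{u\in M}r_{C_u}(T_u).$$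
   Context: A hyperbolic space is a triple $(X,\rho,W)$ where $(X,\rho)$ is a metric space and $W:X\times X\times[0,1]\to X$ satisfies, for all $x,y,z,w\in X$ and $\lambda,\tilde\lambda\in[0,1]$: (W1) $\rho(z,W(x,y,\lambda))\le(1-\lambda)\rho(z,x)+\lambda\rho(z,y)$; (W2) $\rho(W(x,y,\lambda),W(x,y,\tilde\lambda))=|\lambda-\tilde\lambda|\,\rho(x,y)$; (W3) $W(x,y,\lambda)=W(y,x,1-\lambda)$; (W4) $\rho(W(x,z,\lambda),W(y,w,\lambda))\le(1-\lambda)\rho(x,y)+\lambda\rho(z,w)$. A subset $C\subseteq X$ is convex if $W(x,y,\lambda)\in C$ for all $x,y\in C$, $\lambda\in[0,1]$. A map $T$ between metric spaces is nonexpansive if it does not increase distances (1-Lipschitz). For a self-map $T:Y\to Y$ of a metric space $(Y,\rho)$, $r_Y(T):=\inf\{\rho(y,T(y)) : y\in Y\}$. A metric space $Y$ has the approximate fixed point property (AFPP) for nonexpansive mappings if every nonexpansive $T:Y\to Y$ admits a sequence $(u_n)$ in $Y$ with $\rho(u_n,T(u_n))\to0$ (equivalently $r_Y(T)=0$). $(X\times M)_\infty$ is the set $X\times M$ with the metric $d_\infty((x,u),(y,v))=\max\{\rho(x,y),d(u,v)\}$. $P_1:H\to\bigcup_{u\in M}C_u$ is the projection $(x,u)\mapsto x$. Each $T_u$ is nonexpansive. *)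

theory Defs
  imports "HOL-Analysis.Analysis"
begin

definition hyperbolic_space :: "'a metric \<Rightarrow> ('a \<Rightarrow> 'a \<Rightarrow> real \<Rightarrow> 'a) \<Rightarrow> bool" where
  "hyperbolic_space X W \<longleftrightarrow>
     (\<forall>x\<in>mspace X. \<forall>y\<in>mspace X. \<forall>l\<in>{0..1}. W x y l \<in> mspace X) \<and>
     (\<forall>x\<in>mspace X. \<forall>y\<in>mspace X. \<forall>z\<in>mspace X. \<forall>l\<in>{0..1}.
        mdist X z (W x y l) \<le> (1 - l) * mdist X z x + l * mdist X z y) \<and>
     (\<forall>x\<in>mspace X. \<forall>y\<in>mspace X. \<forall>l\<in>{0..1}. \<forall>l'\<in>{0..1}.
        mdist X (W x y l) (W x y l') = \<bar>l - l'\<bar> * mdist X x y) \<and>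
     (\<forall>x\<in>mspace X. \<forall>y\<in>mspace X. \<forall>l\<in>{0..1}. W x y l = W y x (1 - l)) \<and>
     (\<forall>x\<in>mspace X. \<forall>y\<in>mspace X. \<forall>z\<in>mspace X. \<forall>w\<in>mspace X. \<forall>l\<in>{0..1}.
        mdist X (W x z l) (W y w l) \<le> (1 - l) * mdist X x y + l * mdist X z w)"

definition hyperbolic_convex ::
    "'a metric \<Rightarrow> ('a \<Rightarrow> 'a \<Rightarrow> real \<Rightarrow> 'a) \<Rightarrow> 'a set \<Rightarrow> bool" where
  "hyperbolic_convex X W C \<longleftrightarrow>
     C \<subseteq> mspace X \<and> (\<forall>x\<in>C. \<forall>y\<in>C. \<forall>l\<in>{0..1}. W x y l \<in> C)"

definition nonexpansive :: "'a metric \<Rightarrow> 'b metric \<Rightarrow> ('a \<Rightarrow> 'b) \<Rightarrow> bool" where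
  "nonexpansive Y Z f \<longleftrightarrow>
     f \<in> mspace Y \<rightarrow> mspace Z \<and>
     (\<forall>x\<in>mspace Y. \<forall>y\<in>mspace Y. mdist Z (f x) (f y) \<le> mdist Y x y)"

text \<open>The quantity $r_Y(T)$. It is valued in the extended reals, so that infima and suprema always
  exist and finiteness of a supremum is a genuine condition.\<close>

definition min_displacement :: "'a metric \<Rightarrow> ('a \<Rightarrow> 'a) \<Rightarrow> ereal" where
  "min_displacement Y T = (INF y\<in>mspace Y. ereal (mdist Y y (T y)))"

definition AFPP :: "'a metric \<Rightarrow> bool" where
  "AFPP Y \<longleftrightarrow>
     (\<forall>T. nonexpansive Y Y T \<longrightarrow>
        (\<exists>u::nat \<Rightarrow> 'a. range u \<subseteq> mspace Y \<and> (\<lambda>n. mdist Y (u n) (T (u n))) \<longlonglongrightarrow> 0))"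

text \<open>The library's \<open>prod_metric\<close> is the Euclidean product; here the maximum metric is needed.\<close>

definition max_prod_metric :: "'a metric \<Rightarrow> 'b metric \<Rightarrow> ('a \<times> 'b) metric" where
  "max_prod_metric X M =
     metric (mspace X \<times> mspace M, \<lambda>(x, u) (y, v). max (mdist X x y) (mdist M u v))"

lemma Metric_space_max_prod:
  "Metric_space (mspace X \<times> mspace M)
     (\<lambda>(x, u) (y, v). max (mdist X x y) (mdist M u v))"
proof
  fix p q r :: "'a \<times> 'b"
  let ?d = "\<lambda>(x, u) (y, v). max (mdist X x y) (mdist M u v)"
  show "0 \<le> ?d p q"
    by (auto simp: le_max_iff_disj split: prod.splits)
  show "?d p q = ?d q p"
    by (auto simp: mdist_commute split: prod.splits)
  show "?d p q = 0 \<longleftrightarrow> p = q" if "p \<in> mspace X \<times> mspace M" "q \<in> mspace X \<times> mspace M"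
  proof -
    obtain x u y v where [simp]: "p = (x, u)" "q = (y, v)"
      by (metis surj_pair)
    have "0 \<le> mdist X x y" "0 \<le> mdist M u v"
      by simp_all
    then have "max (mdist X x y) (mdist M u v) = 0 \<longleftrightarrow> mdist X x y = 0 \<and> mdist M u v = 0"
      by linarith
    then show ?thesis
      using that by auto
  qed
  show "?d p r \<le> ?d p q + ?d q r"
    if "p \<in> mspace X \<times> mspace M" "q \<in> mspace X \<times> mspace M" "r \<in> mspace X \<times> mspace M"
  proof -
    obtain x u y v z w where [simp]: "p = (x, u)" "q = (y, v)" "r = (z, w)"
      by (metis surj_pair)
    have "mdist X x z \<le> mdist X x y + mdist X y z" "mdist M u w \<le> mdist M u v + mdist M v w"
      using that by (auto intro: mdist_triangle)
    then show ?thesis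
      by simp linarith
  qed
qed

lemma mspace_max_prod_metric [simp]:
  "mspace (max_prod_metric X M) = mspace X \<times> mspace M"
  unfolding max_prod_metric_def
  by (rule Metric_space.mspace_metric[OF Metric_space_max_prod])

lemma mdist_max_prod_metric [simp]:
  "mdist (max_prod_metric X M) = (\<lambda>(x, u) (y, v). max (mdist X x y) (mdist M u v))"
  unfolding max_prod_metric_def
  by (rule Metric_space.mdist_metric[OF Metric_space_max_prod])

definition total_set :: "'b metric \<Rightarrow> ('b \<Rightarrow> 'a set) \<Rightarrow> ('a \<times> 'b) set" where
  "total_set M C = {(x, u). u \<in> mspace M \<and> x \<in> C u}"

definition fibre_map :: "('a \<times> 'b \<Rightarrow> 'a \<times> 'b) \<Rightarrow> 'b \<Rightarrow> 'a \<Rightarrow> 'a" where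
  "fibre_map T u x = (fst \<circ> T) (x, u)"

end

theory Submission
  imports Defs
begin

text \<open>
  For \<open>s < 1\<close> the map \<open>z \<mapsto> W(\<delta>(u), T\<^sub>u z, s)\<close> is an \<open>s\<close>-contraction of \<open>C\<^sub>u\<close>. Its iterates \<open>x\<^sub>n(u)\<close> started
  at \<open>\<delta>(u)\<close> are nonexpansive in \<open>u\<close>, so AFPP of \<open>M\<close> applied to \<open>u \<mapsto> P\<^sub>2 T(x\<^sub>n(u), u)\<close> makes the
  \<open>M\<close>-displacement of \<open>(x\<^sub>n(u), u)\<close> arbitrarily small. The \<open>X\<close>-displacement is at most
  \<open>r + \<epsilon> + 2(1 - s)\<phi>(\<epsilon>) + 2s\<^sup>nK\<close> with \<open>K\<close> independent of \<open>u\<close>, where \<open>r\<close> is the supremum of the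
  fibrewise minimal displacements; let \<open>s\<close> tend to \<open>1\<close> and then \<open>n\<close> to infinity.
\<close>

lemma mdist_self [simp]: "x \<in> mspace m \<Longrightarrow> mdist m x x = 0"
  by simp

text \<open>Finite iterates replace the fixed point of the contraction, which may fail to exist
  since completeness is not assumed. Starting at the anchor itself makes the starting points of
  different fibres comparable through \<delta>.\<close>

definition anchored_iter :: "('a \<Rightarrow> 'a \<Rightarrow> real \<Rightarrow> 'a) \<Rightarrow> real \<Rightarrow> ('a \<Rightarrow> 'a) \<Rightarrow> 'a \<Rightarrow> nat \<Rightarrow> 'a" where
  "anchored_iter W s f a n = ((\<lambda>z. W a (f z) s) ^^ n) a"

lemma anchored_iter_0 [simp]: "anchored_iter W s f a 0 = a"
  by (simp add: anchored_iter_def)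

lemma anchored_iter_Suc [simp]:
  "anchored_iter W s f a (Suc n) = W a (f (anchored_iter W s f a n)) s"
  by (simp add: anchored_iter_def)

lemma anchored_iter_mem:
  assumes "hyperbolic_convex X W C" "a \<in> C" "f \<in> C \<rightarrow> C" "s \<in> {0..1}"
  shows "anchored_iter W s f a n \<in> C"
  by (induction n) (use assms in \<open>auto simp: hyperbolic_convex_def Pi_iff\<close>)

lemma hyperbolic_dist_combination_le:
  assumes "hyperbolic_space X W" "x \<in> mspace X" "y \<in> mspace X" "z \<in> mspace X" "s \<in> {0..1}"
  shows "mdist X z (W x y s) \<le> (1 - s) * mdist X z x + s * mdist X z y"
  using assms unfolding hyperbolic_space_def by blast

lemma hyperbolic_dist_combinations_le:
  assumes "hyperbolic_space X W" "x \<in> mspace X" "y \<in> mspace X" "z \<in> mspace X" "w \<in> mspace X"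
    "s \<in> {0..1}"
  shows "mdist X (W x z s) (W y w s) \<le> (1 - s) * mdist X x y + s * mdist X z w"
  using assms unfolding hyperbolic_space_def by blast

text \<open>Consecutive iterates are combinations with the same anchor \<open>a\<close>, so (W4)
  loses the anchor term and each step contracts by the factor \<open>s\<close>.\<close>

lemma anchored_iter_step_le:
  assumes hyp: "hyperbolic_space X W" and conv: "hyperbolic_convex X W C"
    and a: "a \<in> C" and f: "f \<in> C \<rightarrow> C"
    and ne: "\<And>x y. x \<in> C \<Longrightarrow> y \<in> C \<Longrightarrow> mdist X (f x) (f y) \<le> mdist X x y"
    and s: "s \<in> {0..1}"
  shows "mdist X (anchored_iter W s f a n) (anchored_iter W s f a (Suc n)) \<le> s ^ n * mdist X a (f a)"
proof (induction n)
  case 0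
  have "a \<in> mspace X" "f a \<in> mspace X"
    using conv a f by (auto simp: hyperbolic_convex_def)
  then have "mdist X a (W a (f a) s) \<le> s * mdist X a (f a)"
    using hyperbolic_dist_combination_le[OF hyp, of a "f a" a s] s by simp
  also have "\<dots> \<le> mdist X a (f a)"
    using s by (simp add: mult_left_le_one_le)
  finally show ?case
    by simp
next
  case (Suc n)
  let ?x = "anchored_iter W s f a"
  have x: "?x k \<in> C" for k
    by (rule anchored_iter_mem[OF conv a f s])
  have mem: "a \<in> mspace X" "f (?x k) \<in> mspace X" for k
    using conv a f x[of k] by (auto simp: hyperbolic_convex_def)
  have "mdist X (?x (Suc n)) (?x (Suc (Suc n)))
      \<le> (1 - s) * mdist X a a + s * mdist X (f (?x n)) (f (?x (Suc n)))"
    using hyperbolic_dist_combinations_le[OF hyp mem(1,1) mem(2)[of n] mem(2)[of "Suc n"] s] by simp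
  also have "\<dots> = s * mdist X (f (?x n)) (f (?x (Suc n)))"
    using mem(1) by simp
  also have "\<dots> \<le> s * (s ^ n * mdist X a (f a))"
    using s ne[OF x x, of n "Suc n"] Suc.IH by (intro mult_left_mono) auto
  finally show ?case
    by (simp add: mult.assoc)
qed

text \<open>The point is that the displacement of \<open>x\<close> enters with coefficient 1. Going
  from \<open>x\<close> to \<open>f z\<close> via \<open>f x\<close>, and from \<open>x\<close> to
  \<open>z\<close> via \<open>W a (f z) s\<close>, the distance from \<open>x\<close> to
  \<open>f z\<close> reappears on the right with factor \<open>s\<close>. Absorbing it bounds
  \<open>(1 - s) * mdist X x (f z)\<close> without division by \<open>1 - s\<close>, and exactly
  this product bounds how far \<open>f z\<close> is from the combination.\<close>

lemma displacement_of_approx_anchored_fixed_point: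
  assumes hyp: "hyperbolic_space X W" and conv: "hyperbolic_convex X W C"
    and f: "f \<in> C \<rightarrow> C"
    and ne: "\<And>x y. x \<in> C \<Longrightarrow> y \<in> C \<Longrightarrow> mdist X (f x) (f y) \<le> mdist X x y"
    and s: "s \<in> {0..1}" and C: "a \<in> C" "x \<in> C" "z \<in> C"
    and z: "mdist X z (W a (f z) s) \<le> \<eta>"
  shows "mdist X z (f z) \<le> mdist X x (f x) + 2 * (1 - s) * mdist X a x + 2 * \<eta>"
proof -
  have mem: "a \<in> mspace X" "x \<in> mspace X" "z \<in> mspace X" "f x \<in> mspace X" "f z \<in> mspace X"
    "W a (f z) s \<in> mspace X"
    using conv f C s by (auto simp: hyperbolic_convex_def Pi_iff subset_iff)
  let ?w = "W a (f z) s"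
  have "mdist X z (f z) \<le> mdist X z ?w + mdist X (f z) ?w"
    using mdist_triangle[OF mem(3) mem(6) mem(5)] by (simp add: mdist_commute)
  moreover have "mdist X (f z) ?w \<le> (1 - s) * mdist X a (f z)"
    using hyperbolic_dist_combination_le[OF hyp mem(1,5,5) s] mem(5) by (simp add: mdist_commute)
  moreover have "(1 - s) * mdist X a (f z) \<le> (1 - s) * (mdist X a x + mdist X x (f z))"
    using s mdist_triangle[OF mem(1,2,5)] by (intro mult_left_mono) auto
  moreover have "mdist X x (f z) \<le> mdist X x (f x) + mdist X x z"
    using mdist_triangle[OF mem(2,4,5)] ne[OF C(2,3)] by linarith
  moreover have "mdist X x z \<le> mdist X x ?w + mdist X z ?w"
    using mdist_triangle[OF mem(2,6,3)] by (simp add: mdist_commute)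
  moreover have "mdist X x ?w \<le> (1 - s) * mdist X a x + s * mdist X x (f z)"
    using hyperbolic_dist_combination_le[OF hyp mem(1,5,2) s] by (simp add: mdist_commute)
  ultimately show ?thesis
    using z by (simp add: algebra_simps)
qed

text \<open>This compares two fibres, \<open>d\<close> standing for the distance of their base
  points. Once the iterates are within \<open>d\<close>, the maximum in the hypothesis on
  \<open>f\<close> and \<open>g\<close> collapses to \<open>d\<close>, and (W4) averages two
  distances that are at most \<open>d\<close>.\<close>

lemma max_dist_anchored_iter_le:
  assumes hyp: "hyperbolic_space X W" and sub: "C \<subseteq> mspace X" "D \<subseteq> mspace X"
    and C: "\<And>n. anchored_iter W s f a n \<in> C" "f \<in> C \<rightarrow> C" "a \<in> C"
    and D: "\<And>n. anchored_iter W s g b n \<in> D" "g \<in> D \<rightarrow> D" "b \<in> D"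
    and ab: "mdist X a b \<le> d"
    and fg: "\<And>x y. x \<in> C \<Longrightarrow> y \<in> D \<Longrightarrow> mdist X (f x) (g y) \<le> max (mdist X x y) d"
    and s: "s \<in> {0..1}"
  shows "mdist X (anchored_iter W s f a n) (anchored_iter W s g b n) \<le> d"
proof (induction n)
  case 0
  then show ?case
    using ab by simp
next
  case (Suc n)
  let ?x = "anchored_iter W s f a n" and ?y = "anchored_iter W s g b n"
  have mem: "a \<in> mspace X" "b \<in> mspace X" "f ?x \<in> mspace X" "g ?y \<in> mspace X"
    using C D sub by blast+
  have "mdist X (f ?x) (g ?y) \<le> d"
    using fg[OF C(1) D(1)] Suc by (meson max.bounded_iff max.cobounded2 order_trans order_refl)
  then have "(1 - s) * mdist X a b + s * mdist X (f ?x) (g ?y) \<le> (1 - s) * d + s * d"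
    using ab s by (intro add_mono mult_left_mono) auto
  then show ?case
    using hyperbolic_dist_combinations_le[OF hyp mem s] by (simp add: algebra_simps)
qed

text \<open>The identity is nonexpansive, and the approximating sequence must take values in the
  space.\<close>

lemma AFPP_imp_nonempty: "AFPP M \<Longrightarrow> mspace M \<noteq> {}"
  by (force simp: AFPP_def nonexpansive_def)

lemma AFPP_D:
  assumes "AFPP M" "nonexpansive M M T" "e > 0"
  obtains u where "u \<in> mspace M" "mdist M u (T u) < e"
proof -
  obtain u :: "nat \<Rightarrow> _" where u: "range u \<subseteq> mspace M" "(\<lambda>n. mdist M (u n) (T (u n))) \<longlonglongrightarrow> 0"
    using assms unfolding AFPP_def by blast
  then obtain n where "mdist M (u n) (T (u n)) < e"
    using order_tendstoD(2)[OF u(2) assms(3)] by (auto simp: eventually_sequentially)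
  then show ?thesis
    using u(1) that by blast
qed

lemma min_displacement_nonneg: "0 \<le> min_displacement Y T"
  by (auto simp: min_displacement_def intro: INF_greatest)

theorem theorem2p9:
  fixes X :: "'a metric" and W :: "'a \<Rightarrow> 'a \<Rightarrow> real \<Rightarrow> 'a"
    and M :: "'b metric" and C :: "'b \<Rightarrow> 'a set"
    and \<delta> :: "'b \<Rightarrow> 'a" and T :: "'a \<times> 'b \<Rightarrow> 'a \<times> 'b"
    and \<phi> :: "real \<Rightarrow> real"
  assumes "hyperbolic_space X W"
    and "AFPP M"
    and "\<And>u. u \<in> mspace M \<Longrightarrow> C u \<noteq> {} \<and> hyperbolic_convex X W (C u)"
    and "nonexpansive M (submetric X (\<Union>u\<in>mspace M. C u)) \<delta>"
    and "\<And>u. u \<in> mspace M \<Longrightarrow> \<delta> u \<in> C u"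
    and "nonexpansive (submetric (max_prod_metric X M) (total_set M C))
           (submetric (max_prod_metric X M) (total_set M C)) T"
    and "\<And>x u. (x, u) \<in> total_set M C \<Longrightarrow> (fst \<circ> T) (x, u) \<in> C u"
    and "(SUP u\<in>mspace M. min_displacement (submetric X (C u)) (fibre_map T u)) < \<infinity>"
    and "\<And>\<epsilon>. \<epsilon> > 0 \<Longrightarrow> \<phi> \<epsilon> > 0"
    and "\<And>\<epsilon> v. \<epsilon> > 0 \<Longrightarrow> v \<in> mspace M \<Longrightarrow>
           \<exists>x\<in>C v. mdist X (\<delta> v) x \<le> \<phi> \<epsilon> \<and>
             ereal (mdist X x (fibre_map T v x)) \<le>
               (SUP u\<in>mspace M. min_displacement (submetric X (C u)) (fibre_map T u)) + ereal \<epsilon>"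
  shows "min_displacement (submetric (max_prod_metric X M) (total_set M C)) T \<le>
           (SUP u\<in>mspace M. min_displacement (submetric X (C u)) (fibre_map T u))"
proof -
  note hyp = assms(1) and afpp = assms(2)
  let ?H = "total_set M C"
  let ?r = "SUP u\<in>mspace M. min_displacement (submetric X (C u)) (fibre_map T u)"
  obtain u0 where u0: "u0 \<in> mspace M"
    using AFPP_imp_nonempty[OF afpp] by blast
  \<comment> \<open>An empty supremum would be minus infinity in \<open>ereal\<close>; the point
    \<open>u0\<close> excludes this, so \<open>?r\<close> is a nonnegative real.\<close>
  have "0 \<le> ?r"
    by (rule SUP_upper2[OF u0 min_displacement_nonneg])
  with assms(8) obtain r where r: "?r = ereal r" "0 \<le> r"
    by (cases ?r) auto
  have conv: "hyperbolic_convex X W (C u)" and sub: "C u \<subseteq> mspace X" if "u \<in> mspace M" for u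
    using assms(3)[OF that] by (auto simp: hyperbolic_convex_def)
  have Hsub: "?H \<subseteq> mspace X \<times> mspace M"
    using sub by (auto simp: total_set_def)
  have \<delta>: "mdist X (\<delta> u) (\<delta> v) \<le> mdist M u v" if "u \<in> mspace M" "v \<in> mspace M" for u v
    using assms(4) that by (auto simp: nonexpansive_def)
  have T_mem: "T p \<in> ?H" if "p \<in> ?H" for p
    using assms(6) that Hsub by (auto simp: nonexpansive_def Pi_iff)
  have T_ne: "mdist (max_prod_metric X M) (T p) (T q) \<le> mdist (max_prod_metric X M) p q"
    if "p \<in> ?H" "q \<in> ?H" for p q
    using assms(6) that unfolding nonexpansive_def mspace_submetric mdist_submetric
      mspace_max_prod_metric Int_absorb1[OF Hsub] Int_absorb2[OF Hsub] by blast
  \<comment> \<open>The maximum metric bounds each coordinate of \<open>T\<close> separately, but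
    only by the maximum over both coordinates of the arguments.\<close>
  have T_fst: "mdist X (fibre_map T u x) (fibre_map T v y) \<le> max (mdist X x y) (mdist M u v)"
    and T_snd: "mdist M (snd (T (x, u))) (snd (T (y, v))) \<le> max (mdist X x y) (mdist M u v)"
    if "u \<in> mspace M" "v \<in> mspace M" "x \<in> C u" "y \<in> C v" for x y u v
    using T_ne[of "(x, u)" "(y, v)"] that
    by (auto simp: total_set_def fibre_map_def case_prod_beta)
  have fib: "fibre_map T u \<in> C u \<rightarrow> C u" if "u \<in> mspace M" for u
    using assms(7) that by (auto simp: total_set_def fibre_map_def)
  have fib_ne: "mdist X (fibre_map T u x) (fibre_map T u y) \<le> mdist X x y"
    if "u \<in> mspace M" "x \<in> C u" "y \<in> C u" for u x y
    using T_fst[of u u x y] that by simp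
  have "min_displacement (submetric (max_prod_metric X M) ?H) T \<le> ereal r + ereal e"
    if e: "0 < e" for e
  proof -
    \<comment> \<open>Each of \<open>\<epsilon>\<close>,
      \<open>2 * (1 - s) * \<phi> \<epsilon>\<close> and twice the residual of the iterate costs at
      most \<open>e / 4\<close>, which leaves the final displacement below
      \<open>r + e\<close>.\<close>
    define \<epsilon> where "\<epsilon> = e / 4"
    define t where "t = min (1 / 2) (e / (8 * \<phi> \<epsilon>))"
    define s where "s = 1 - t"
    \<comment> \<open>\<open>K\<close> will bound the displacement of \<delta> \<open>u\<close>
      under the fibre map for every \<open>u\<close>, by a detour through an almost optimal point.
      Hence one \<open>n\<close> serves all fibres, as the comparison of iterates across fibres
      requires.\<close>
    define K where "K = 2 * \<phi> \<epsilon> + r + \<epsilon>"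
    have \<epsilon>: "0 < \<epsilon>"
      using e by (simp add: \<epsilon>_def)
    have \<phi>: "0 < \<phi> \<epsilon>"
      by (rule assms(9)[OF \<epsilon>])
    have t: "0 < t" "t \<le> 1 / 2"
      using e \<phi> by (auto simp: t_def)
    have "t \<le> e / (8 * \<phi> \<epsilon>)"
      by (simp add: t_def)
    then have t\<phi>: "t * \<phi> \<epsilon> \<le> e / 8"
      using \<phi> by (simp add: field_simps)
    have s: "s \<in> {0..1}" "s < 1" "0 \<le> s"
      using t by (auto simp: s_def)
    have K: "0 < K"
      using \<phi> r \<epsilon> by (simp add: K_def)
    have "0 < e / (8 * K)"
      using e K by simp
    then obtain n where "s ^ n < e / (8 * K)"
      using real_arch_pow_inv s(2) by blast
    then have n: "s ^ n * K \<le> e / 8"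
      using K by (simp add: field_simps)
    define x where "x u = anchored_iter W s (fibre_map T u) (\<delta> u) n" for u
    have iter_mem: "anchored_iter W s (fibre_map T u) (\<delta> u) k \<in> C u" if "u \<in> mspace M" for u k
      using anchored_iter_mem[OF conv[OF that] assms(5)[OF that] fib[OF that] s(1)] .
    have x_mem: "x u \<in> C u" if "u \<in> mspace M" for u
      using iter_mem[OF that] by (simp add: x_def)
    have x_ne: "mdist X (x u) (x v) \<le> mdist M u v" if "u \<in> mspace M" "v \<in> mspace M" for u v
      unfolding x_def using that
      by (intro max_dist_anchored_iter_le[OF hyp sub[OF that(1)] sub[OF that(2)]]
            iter_mem fib assms(5) \<delta> T_fst s(1))
    have displ: "mdist X (x u) (fibre_map T u (x u)) \<le> r + e" if u: "u \<in> mspace M" for u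
    proof -
      obtain y where y: "y \<in> C u" "mdist X (\<delta> u) y \<le> \<phi> \<epsilon>" "mdist X y (fibre_map T u y) \<le> r + \<epsilon>"
        using assms(10)[OF \<epsilon> u] unfolding r(1) by auto
      have mem: "\<delta> u \<in> mspace X" "y \<in> mspace X" "fibre_map T u y \<in> mspace X"
        "fibre_map T u (\<delta> u) \<in> mspace X"
        using assms(5)[OF u] y(1) fib[OF u] sub[OF u] by auto
      have "mdist X (\<delta> u) (fibre_map T u (\<delta> u)) \<le> mdist X (\<delta> u) y
          + (mdist X y (fibre_map T u y) + mdist X (fibre_map T u y) (fibre_map T u (\<delta> u)))"
        using mdist_triangle[OF mem(1,2,4)] mdist_triangle[OF mem(2,3,4)] by linarith
      also have "\<dots> \<le> K"
        using y fib_ne[OF u y(1) assms(5)[OF u]] by (simp add: K_def mdist_commute)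
      finally have "s ^ n * mdist X (\<delta> u) (fibre_map T u (\<delta> u)) \<le> s ^ n * K"
        using s by (intro mult_left_mono) auto
      then have step: "mdist X (x u) (W (\<delta> u) (fibre_map T u (x u)) s) \<le> e / 8"
        using anchored_iter_step_le[OF hyp conv[OF u] assms(5)[OF u] fib[OF u] fib_ne[OF u] s(1), of n] n
        by (simp add: x_def)
      have "mdist X (x u) (fibre_map T u (x u))
          \<le> mdist X y (fibre_map T u y) + 2 * (1 - s) * mdist X (\<delta> u) y + 2 * (e / 8)"
        by (rule displacement_of_approx_anchored_fixed_point[OF hyp conv[OF u] fib[OF u] fib_ne[OF u]
              s(1) assms(5)[OF u] y(1) x_mem[OF u] step])
      moreover have "2 * (1 - s) * mdist X (\<delta> u) y \<le> e / 4"
        using order_trans[OF mult_left_mono[OF y(2)] t\<phi>] t(1) by (simp add: s_def)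
      ultimately show ?thesis
        using y(3) e unfolding \<epsilon>_def by linarith
    qed
    \<comment> \<open>By \<open>x_ne\<close> the point \<open>(x u, u)\<close> moves no more than
      \<open>u\<close> does, so the maximum in \<open>T_snd\<close> is the distance in
      \<open>M\<close>.\<close>
    have "nonexpansive M M (\<lambda>u. snd (T (x u, u)))"
      unfolding nonexpansive_def
    proof (intro conjI ballI funcsetI)
      show "snd (T (x u, u)) \<in> mspace M" if "u \<in> mspace M" for u
        using T_mem[of "(x u, u)"] that x_mem[OF that] by (auto simp: total_set_def)
      show "mdist M (snd (T (x u, u))) (snd (T (x v, v))) \<le> mdist M u v"
        if "u \<in> mspace M" "v \<in> mspace M" for u v
        using T_snd[OF that x_mem[OF that(1)] x_mem[OF that(2)]] x_ne[OF that] by simp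
    qed
    then obtain u where u: "u \<in> mspace M" "mdist M u (snd (T (x u, u))) < e"
      by (rule AFPP_D[OF afpp _ e])
    have "(x u, u) \<in> ?H"
      using u(1) x_mem by (simp add: total_set_def)
    then have "min_displacement (submetric (max_prod_metric X M) ?H) T
        \<le> ereal (mdist (max_prod_metric X M) (x u, u) (T (x u, u)))"
      unfolding min_displacement_def mspace_submetric mdist_submetric mspace_max_prod_metric
        Int_absorb1[OF Hsub] Int_absorb2[OF Hsub] by (rule INF_lower)
    \<comment> \<open>The first coordinate is controlled by \<open>displ\<close> at every
      \<open>u\<close>, the second by the choice of \<open>u\<close>; its bound \<open>e\<close> is
      at most \<open>r + e\<close> because \<open>r\<close> is nonnegative.\<close>
    also have "\<dots> \<le> ereal (r + e)"
      using displ[OF u(1)] u(2) r(2) by (simp add: fibre_map_def case_prod_beta)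
    finally show ?thesis
      by simp
  qed
  then show ?thesis
    unfolding r(1) by (rule ereal_le_epsilon2)
qed

end
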